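(* Let $G$ be a graph. Then $G$ is a $(\gamma,\alpha_c)$-perfect graph if and only if $G$ does not contain any of the ten graphs $H_1,\ldots,H_{10}$ (defined in the context) as an induced subgraph.
   Context: All graphs are finite, simple, undirected, with nonempty vertex set. A dominating set of a graph $G$ is a set $S\subseteq V(G)$ such that every vertex not in $S$ has a neighbor in $S$; the domination number $\gamma(G)$ is the minimum cardinality of a dominating set of $G$. The common independence number $\alpha_c(G)$ is the greatest integer $r$ such that every vertex of $G$ belongs to some independent set of $G$ of cardinality at least $r$. A graph $G$ is $(\gamma,\alpha_c)$-perfect (also called common domination perfect) if $\gamma(H)=\alpha_c(H)$ for every induced subgraph $H$ of $G$. A graph contains $F$ as an induced subgraph if some induced subgraph of it is isomorphic to $F$. The graphs $H_1,\ldots,H_{10}$ each have the six vertices $a,a_1,a_2,b,b_1,b_2$. All ten contain the edges $aa_1,\ aa_2,\ bb_1,\ bb_2$, and their remaining edges are exactly the following: $H_1$: $ab$; $H_2$: $ab,\ a_2b_1$; $H_3$: $ab,\ a_2b_1,\ a_2b_2$; $H_4$: $ab,\ a_1b_1,\ a_1b_2,\ a_2b_1,\ a_2b_2$ (so $H_4\cong K_{3,3}$); $H_5$: $ab,\ a_2b_1,\ a_1b_2$; $H_6$: $ab,\ a_2b_1,\ a_2b_2,\ a_1b_2$ (so $H_6$ is $K_{3,3}$ minus an edge); $H_7$: no further edges (so $H_7\cong 2P_3$, the disjoint union of two paths on three vertices); $H_8$: $a_1b_1$ (so $H_8\cong P_6$, the path on six vertices); $H_9$: $a_1b_1,\ a_2b_2$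 (so $H_9\cong C_6$, the cycle on six vertices); $H_{10}$: $a_1b_1,\ a_1b_2$ (so $H_{10}$ is the 4-cycle $a_1b_1bb_2$ together with the path $a_1,a,a_2$ attached at $a_1$). *)

theory Defs
  imports "Graph_Theory.Graph_Theory"
begin

text \<open>
  Finite simple undirected graphs are the \<open>pair_graph\<close>s of Graph_Theory: finite, loop-free digraphs
  whose arc set is a symmetric set of ordered pairs, so that an edge \<open>uv\<close> is present as both
  \<open>(u, v)\<close> and \<open>(v, u)\<close>. The library admits the null graph; its exclusion is stated explicitly.
\<close>

definition dominating_set :: "'a pair_pre_digraph \<Rightarrow> 'a set \<Rightarrow> bool" where
  "dominating_set G S \<longleftrightarrow>
     S \<subseteq> pverts G \<and> (\<forall>v \<in> pverts G - S. \<exists>u \<in> S. (v, u) \<in> parcs G)"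

definition domination_number :: "'a pair_pre_digraph \<Rightarrow> nat" where
  "domination_number G = (LEAST k. \<exists>S. dominating_set G S \<and> card S = k)"

definition independent_set :: "'a pair_pre_digraph \<Rightarrow> 'a set \<Rightarrow> bool" where
  "independent_set G S \<longleftrightarrow> S \<subseteq> pverts G \<and> (\<forall>u \<in> S. \<forall>v \<in> S. (u, v) \<notin> parcs G)"

definition common_independence_number :: "'a pair_pre_digraph \<Rightarrow> nat" where
  "common_independence_number G =
     (GREATEST r. \<forall>v \<in> pverts G. \<exists>S. independent_set G S \<and> v \<in> S \<and> r \<le> card S)"

definition common_domination_perfect :: "'a pair_pre_digraph \<Rightarrow> bool" where
  "common_domination_perfect G \<longleftrightarrow>
     (\<forall>H :: 'a pair_pre_digraph.
        induced_subgraph (with_proj H) (with_proj G) \<and> pverts H \<noteq> {} \<longrightarrow>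
        domination_number H = common_independence_number H)"

definition contains_induced :: "'a pair_pre_digraph \<Rightarrow> 'b pair_pre_digraph \<Rightarrow> bool" where
  "contains_induced G F \<longleftrightarrow>
     (\<exists>H :: 'a pair_pre_digraph.
        induced_subgraph (with_proj H) (with_proj G) \<and> digraph_iso (with_proj H) (with_proj F))"

datatype six_vertex = Va | Va1 | Va2 | Vb | Vb1 | Vb2

text \<open>The four edges common to all ten graphs, together with further edges \<open>E\<close>.\<close>

definition six_graph :: "six_vertex rel \<Rightarrow> six_vertex pair_pre_digraph" where
  "six_graph E =
     (let E' = {(Va, Va1), (Va, Va2), (Vb, Vb1), (Vb, Vb2)} \<union> E
      in \<lparr> pverts = UNIV, parcs = E' \<union> E'\<inverse> \<rparr>)"

definition "H1 = six_graph {(Va, Vb)}"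
definition "H2 = six_graph {(Va, Vb), (Va2, Vb1)}"
definition "H3 = six_graph {(Va, Vb), (Va2, Vb1), (Va2, Vb2)}"
definition "H4 = six_graph {(Va, Vb), (Va1, Vb1), (Va1, Vb2), (Va2, Vb1), (Va2, Vb2)}"
definition "H5 = six_graph {(Va, Vb), (Va2, Vb1), (Va1, Vb2)}"
definition "H6 = six_graph {(Va, Vb), (Va2, Vb1), (Va2, Vb2), (Va1, Vb2)}"
definition "H7 = six_graph {}"
definition "H8 = six_graph {(Va1, Vb1)}"
definition "H9 = six_graph {(Va1, Vb1), (Va2, Vb2)}"
definition "H10 = six_graph {(Va1, Vb1), (Va1, Vb2)}"

lemma finite_six_vertex: "finite (A :: six_vertex set)"
proof (rule finite_subset)
  show "A \<subseteq> {Va, Va1, Va2, Vb, Vb1, Vb2}"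
    using six_vertex.exhaust by blast
qed simp

lemma pair_graph_six_graph:
  assumes "irrefl E"
  shows "pair_graph (six_graph E)"
proof
  have "finite (UNIV :: (six_vertex \<times> six_vertex) set)"
    by (metis finite_six_vertex finite_Prod_UNIV)
  then show "finite (parcs (six_graph E))"
    by (rule rev_finite_subset) simp
  show "symmetric (with_proj (six_graph E))"
    by (auto simp: symmetric_def sym_def six_graph_def Let_def)
  show "fst e \<noteq> snd e" if "e \<in> parcs (six_graph E)" for e
    using that assms by (cases e) (auto simp: six_graph_def Let_def irrefl_def)
qed (simp_all add: six_graph_def Let_def finite_six_vertex)

lemma pair_graph_forbidden:
  "\<forall>F \<in> {H1, H2, H3, H4, H5, H6, H7, H8, H9, H10}. pair_graph F"
  unfolding H1_def H2_def H3_def H4_def H5_def H6_def H7_def H8_def H9_def H10_def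
  by (auto intro!: pair_graph_six_graph simp: irrefl_def)

text \<open>
  The minimum and the maximum in the two parameters are attained; for the maximum, the vertex set
  has to be nonempty and finite.
\<close>

lemma domination_number_attained:
  "\<exists>S. dominating_set G S \<and> card S = domination_number G"
  unfolding domination_number_def
  by (rule LeastI_ex) (auto simp: dominating_set_def)

lemma common_independence_number_attained:
  assumes "pair_graph G" "pverts G \<noteq> {}"
  shows "\<forall>v \<in> pverts G. \<exists>S. independent_set G S \<and> v \<in> S \<and> common_independence_number G \<le> card S"
    and "(\<And>v. v \<in> pverts G \<Longrightarrow> \<exists>S. independent_set G S \<and> v \<in> S \<and> r \<le> card S)
           \<Longrightarrow> r \<le> common_independence_number G"
proof -
  interpret pair_graph G by fact
  let ?P = "\<lambda>r. \<forall>v \<in> pverts G. \<exists>S. independent_set G S \<and> v \<in> S \<and> r \<le> card S"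
  have zero: "?P 0"
  proof
    fix v assume "v \<in> pverts G"
    then have "independent_set G {v}"
      using pair_no_loops by (force simp: independent_set_def)
    then show "\<exists>S. independent_set G S \<and> v \<in> S \<and> 0 \<le> card S" by blast
  qed
  have bound: "\<forall>r. ?P r \<longrightarrow> r \<le> card (pverts G)"
  proof (intro allI impI)
    fix r assume "?P r"
    moreover obtain v where "v \<in> pverts G" using assms(2) by blast
    ultimately obtain S where "independent_set G S" "r \<le> card S" by blast
    then show "r \<le> card (pverts G)"
      using card_mono[OF pair_finite_verts, of S] by (auto simp: independent_set_def)
  qed
  show "?P (common_independence_number G)"
    unfolding common_independence_number_def
    using GreatestI_nat[of ?P, OF zero] bound by blast
  show "r \<le> common_independence_number G"
    if "\<And>v. v \<in> pverts G \<Longrightarrow> \<exists>S. independent_set G S \<and> v \<in> S \<and> r \<le> card S"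
    unfolding common_independence_number_def
    using Greatest_le_nat[of ?P r] bound that by blast
qed

end

theory Submission
  imports Defs
begin

text \<open>
  Each \<open>H\<^sub>i\<close> consists of two cherries \<open>a\<^sub>1 a a\<^sub>2\<close> and \<open>b\<^sub>1 b b\<^sub>2\<close> for which \<open>{a, b\<^sub>1, b\<^sub>2}\<close> and
  \<open>{b, a\<^sub>1, a\<^sub>2}\<close> are independent, and conversely every such crossed pair of cherries induces one of
  the ten graphs. These have domination number at most 2 and common independence number at least 3.

  If a graph has no crossed pair of cherries, then for all vertices \<open>a \<noteq> b\<close> one of \<open>N[b] - N[a]\<close>
  and \<open>N[a] - N[b]\<close> is a clique. Adding the vertices of a minimum dominating set \<open>S\<close> one at a
  time, one keeps a root \<open>a\<close> such that everything dominated so far is covered by \<open>N[a]\<close> and one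
  clique for each further vertex: if \<open>N[s] - N[a]\<close> is a clique, the root stays, and otherwise the
  new vertex \<open>s\<close> becomes the root. Hence an independent set through the final root has at most
  \<open>card S\<close> elements.
\<close>

section \<open>Induced subgraphs\<close>

text \<open>All digraphs \<open>with_proj\<close> share the projections as tail and head, so
  compatibility is automatic, and well-formedness of \<open>H\<close> follows from the arc
  condition.\<close>

lemma (in pair_wf_digraph) induced_subgraph_with_proj_iff:
  "induced_subgraph (with_proj H) (with_proj G) \<longleftrightarrow>
     pverts H \<subseteq> pverts G \<and> parcs H = {e \<in> parcs G. fst e \<in> pverts H \<and> snd e \<in> pverts H}"
proof -
  have "wf_digraph (with_proj H)"
    if "parcs H = {e \<in> parcs G. fst e \<in> pverts H \<and> snd e \<in> pverts H}"
    using that by unfold_locales auto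
  moreover have "wf_digraph (with_proj G)"
    by unfold_locales
  ultimately show ?thesis
    by (auto simp: induced_subgraph_def subgraph_def compatible_def)
qed

lemma (in pair_graph) pair_graph_induced_subgraph:
  assumes "induced_subgraph (with_proj H) (with_proj G)"
  shows "pair_graph H"
proof
  note H = assms[unfolded induced_subgraph_with_proj_iff]
  show "finite (pverts H)" "finite (parcs H)"
    using H pair_finite_verts pair_finite_arcs by (auto intro: finite_subset)
  show "symmetric (with_proj H)"
    using H pair_sym_arcs by (auto simp: symmetric_def sym_def)
  fix e assume "e \<in> parcs H"
  then have e: "e \<in> parcs G" "fst e \<in> pverts H" "snd e \<in> pverts H"
    unfolding H[THEN conjunct2] by simp_all
  then show "fst e \<in> pverts H" "snd e \<in> pverts H" "fst e \<noteq> snd e"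
    by (simp_all add: pair_no_loops)
qed

text \<open>With its converse below, this trades \<open>digraph_iso\<close> for a vertex embedding
  \<open>f\<close> that preserves and reflects arcs.\<close>

lemma (in pair_wf_digraph) contains_inducedI:
  assumes inj: "inj_on f (pverts F)" and verts: "f ` pverts F \<subseteq> pverts G"
    and F: "pair_wf_digraph F"
    and arcs: "\<And>x y. x \<in> pverts F \<Longrightarrow> y \<in> pverts F \<Longrightarrow>
      (x, y) \<in> parcs F \<longleftrightarrow> (f x, f y) \<in> parcs G"
  shows "contains_induced G F"
proof -
  interpret F: pair_wf_digraph F by fact
  define H where "H = \<lparr>pverts = f ` pverts F,
    parcs = {e \<in> parcs G. fst e \<in> f ` pverts F \<and> snd e \<in> f ` pverts F}\<rparr>"
  \<comment> \<open>\<open>app_iso\<close> takes the tail and head maps of the image from the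
    isomorphism itself, so they have to be the projections.\<close>
  let ?iso = "\<lparr>iso_verts = f, iso_arcs = map_prod f f, iso_head = snd, iso_tail = fst\<rparr>"
  have wf: "(x, y) \<in> parcs F \<Longrightarrow> x \<in> pverts F \<and> y \<in> pverts F" for x y
    using F.arc_fst_in_verts F.arc_snd_in_verts by fastforce
  have "inj_on (map_prod f f) (parcs F)"
    using inj wf by (auto simp: inj_on_def)
  then have "pre_digraph.digraph_isomorphism (with_proj F) ?iso"
    using inj by (auto simp: pre_digraph.digraph_isomorphism_def F.wf_digraph_axioms)
  moreover have "map_prod f f ` parcs F = parcs H"
  proof (intro equalityI subsetI)
    fix e assume "e \<in> parcs H"
    then obtain x y where "e = (f x, f y)" "x \<in> pverts F" "y \<in> pverts F" "(f x, f y) \<in> parcs G"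
      by (cases e) (auto simp: H_def)
    then show "e \<in> map_prod f f ` parcs F"
      using arcs[of x y] by force
  next
    fix e assume "e \<in> map_prod f f ` parcs F"
    then obtain x y where "(x, y) \<in> parcs F" "e = (f x, f y)"
      by auto
    then show "e \<in> parcs H"
      using arcs[of x y] wf[of x y] by (simp add: H_def)
  qed
  then have "with_proj H = app_iso ?iso (with_proj F)"
    by (simp add: with_proj_def app_iso_def) (simp add: H_def)
  ultimately have "digraph_iso (with_proj F) (with_proj H)"
    by (auto simp: digraph_iso_def)
  then have "digraph_iso (with_proj H) (with_proj F)"
    by (rule digraph_iso_swap[OF F.wf_digraph_axioms])
  moreover have "induced_subgraph (with_proj H) (with_proj G)"
    using verts by (simp add: induced_subgraph_with_proj_iff H_def)
  ultimately show ?thesis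
    unfolding contains_induced_def by blast
qed

lemma (in pair_wf_digraph) contains_inducedE:
  assumes "contains_induced G F" and F: "pair_wf_digraph F"
  obtains f where "inj_on f (pverts F)" "f ` pverts F \<subseteq> pverts G"
    "\<And>x y. x \<in> pverts F \<Longrightarrow> y \<in> pverts F \<Longrightarrow> (x, y) \<in> parcs F \<longleftrightarrow> (f x, f y) \<in> parcs G"
proof -
  interpret F: pair_wf_digraph F by fact
  obtain H where H: "induced_subgraph (with_proj H) (with_proj G)"
    and iso: "digraph_iso (with_proj H) (with_proj F)"
    using assms(1) by (auto simp: contains_induced_def)
  have "wf_digraph (with_proj H)"
    using H by (auto simp: induced_subgraph_def subgraph_def)
  from digraph_iso_swap[OF this iso] obtain h
    where h: "pre_digraph.digraph_isomorphism (with_proj F) h"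
      and H_eq: "with_proj H = app_iso h (with_proj F)"
    by (auto simp: digraph_iso_def)
  let ?f = "iso_verts h"
  have verts: "?f ` pverts F = pverts H" and arcs: "iso_arcs h ` parcs F = parcs H"
    and ends: "iso_tail h = fst" "iso_head h = snd"
    using H_eq by (auto simp: with_proj_def app_iso_def)
  \<comment> \<open>As tail and head of the image are the projections, compatibility with end
    vertices forces the arc map to act as \<open>?f\<close> on both ends.\<close>
  have inj: "inj_on ?f (pverts F)"
    and h_arc: "\<And>e. e \<in> parcs F \<Longrightarrow> iso_arcs h e = (?f (fst e), ?f (snd e))"
    using h ends by (auto simp: pre_digraph.digraph_isomorphism_def prod_eq_iff)
  show thesis
  proof
    show "?f ` pverts F \<subseteq> pverts G"
      using verts H by (auto simp: induced_subgraph_with_proj_iff)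
    fix x y assume xy: "x \<in> pverts F" "y \<in> pverts F"
    have "(x, y) \<in> parcs F \<longleftrightarrow> (?f x, ?f y) \<in> parcs H"
    proof
      assume "(?f x, ?f y) \<in> parcs H"
      then obtain e where e: "e \<in> parcs F" "iso_arcs h e = (?f x, ?f y)"
        using arcs by (metis imageE)
      then have "?f (fst e) = ?f x" "?f (snd e) = ?f y"
        using h_arc by auto
      then have "e = (x, y)"
        using e(1) xy inj F.arc_fst_in_verts F.arc_snd_in_verts
        by (metis inj_onD prod.collapse)
      then show "(x, y) \<in> parcs F" using e by simp
    qed (use arcs h_arc in force)
    also have "\<dots> \<longleftrightarrow> (?f x, ?f y) \<in> parcs G"
      using H verts xy by (auto simp: induced_subgraph_with_proj_iff)
    finally show "(x, y) \<in> parcs F \<longleftrightarrow> (?f x, ?f y) \<in> parcs G" .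
  qed (rule inj)
qed

section \<open>Crossed cherries\<close>

text \<open>The pair \<open>a\<close>, \<open>b\<close> and the four pairs \<open>ai\<close>,
  \<open>bj\<close> are left open: which of them are edges is what tells the ten graphs
  apart.\<close>

definition crossed_cherries ::
    "'a pair_pre_digraph \<Rightarrow> 'a \<Rightarrow> 'a \<Rightarrow> 'a \<Rightarrow> 'a \<Rightarrow> 'a \<Rightarrow> 'a \<Rightarrow> bool" where
  "crossed_cherries G a a1 a2 b b1 b2 \<longleftrightarrow>
     distinct [a, a1, a2, b, b1, b2] \<and>
     (a, a1) \<in> parcs G \<and> (a, a2) \<in> parcs G \<and> (b, b1) \<in> parcs G \<and> (b, b2) \<in> parcs G \<and>
     (a, b1) \<notin> parcs G \<and> (a, b2) \<notin> parcs G \<and> (b1, b2) \<notin> parcs G \<and>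
     (b, a1) \<notin> parcs G \<and> (b, a2) \<notin> parcs G \<and> (a1, a2) \<notin> parcs G"

lemma (in pair_graph) parcs_sym: "(u, v) \<in> parcs G \<longleftrightarrow> (v, u) \<in> parcs G"
  using pair_sym_arcs by (auto simp: symmetric_def sym_def)

lemma (in pair_graph) parcs_irrefl: "(u, u) \<notin> parcs G"
  using pair_no_loops by fastforce

lemma (in pair_graph) parcs_pverts:
  assumes "(u, v) \<in> parcs G"
  shows "u \<in> pverts G" "v \<in> pverts G"
  using assms arc_fst_in_verts arc_snd_in_verts by fastforce+

lemmas forbidden_defs =
  H1_def H2_def H3_def H4_def H5_def H6_def H7_def H8_def H9_def H10_def

lemma pverts_six_graph [simp]: "pverts (six_graph E) = UNIV"
  by (simp add: six_graph_def Let_def)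

lemma parcs_six_graph:
  "parcs (six_graph E) =
     (let E' = {(Va, Va1), (Va, Va2), (Vb, Vb1), (Vb, Vb2)} \<union> E in E' \<union> E'\<inverse>)"
  by (simp add: six_graph_def Let_def)

text \<open>The labelled vertices of \<open>F\<close> are crossed cherries in \<open>F\<close>, and
  an embedding transports distinctness, arcs and non-arcs.\<close>

lemma (in pair_graph) crossed_cherries_of_forbidden:
  assumes "F \<in> {H1, H2, H3, H4, H5, H6, H7, H8, H9, H10}" and "contains_induced G F"
  shows "\<exists>a a1 a2 b b1 b2. crossed_cherries G a a1 a2 b b1 b2"
proof -
  interpret F: pair_graph F
    using assms(1) pair_graph_forbidden by blast
  have UNIV: "pverts F = UNIV"
    using assms(1) by (auto simp: forbidden_defs)
  obtain f where f: "inj f" "\<And>x y. (x, y) \<in> parcs F \<longleftrightarrow> (f x, f y) \<in> parcs G"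
    using contains_inducedE[OF assms(2) F.pair_wf_digraph_axioms] unfolding UNIV
    by (metis UNIV_I)
  have "crossed_cherries F Va Va1 Va2 Vb Vb1 Vb2"
    using assms(1)
    by (auto simp: crossed_cherries_def forbidden_defs parcs_six_graph)
  then have "crossed_cherries G (f Va) (f Va1) (f Va2) (f Vb) (f Vb1) (f Vb2)"
    using f by (simp add: crossed_cherries_def inj_eq)
  then show ?thesis by blast
qed

section \<open>From crossed cherries to one of the ten graphs\<close>

lemma all_six_vertex:
  "(\<forall>x. P x) \<longleftrightarrow> P Va \<and> P Va1 \<and> P Va2 \<and> P Vb \<and> P Vb1 \<and> P Vb2"
  by (metis six_vertex.exhaust)

lemma (in pair_graph) contains_six_graphI:
  fixes a a1 a2 b b1 b2
  defines "f \<equiv> case_six_vertex a a1 a2 b b1 b2"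
  assumes cc: "crossed_cherries G a a1 a2 b b1 b2" and "irrefl E"
    and arcs: "\<forall>x y. (x, y) \<in> parcs (six_graph E) \<longleftrightarrow> (f x, f y) \<in> parcs G"
  shows "contains_induced G (six_graph E)"
proof (rule contains_inducedI[where f = f])
  have "\<forall>x y. f x = f y \<longrightarrow> x = y"
    using cc unfolding all_six_vertex f_def by (auto simp: crossed_cherries_def)
  then show "inj_on f (pverts (six_graph E))" by (auto intro: inj_onI)
  have "\<forall>x. f x \<in> pverts G"
    using cc unfolding all_six_vertex f_def
    by (auto simp: crossed_cherries_def dest: parcs_pverts)
  then show "f ` pverts (six_graph E) \<subseteq> pverts G" by auto
  show "pair_wf_digraph (six_graph E)"
    using pair_graph_six_graph[OF \<open>irrefl E\<close>]
    by (simp add: pair_graph_def pair_digraph_def pair_fin_digraph_def)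
  show "((x, y) \<in> parcs (six_graph E)) = ((f x, f y) \<in> parcs G)" for x y
    by (rule arcs[THEN spec, THEN spec])
qed

text \<open>Up to exchanging the cherries or the leaves of one cherry, the edges between the two
  leaf pairs are: none, one, two with a common end, two disjoint, three, or four. If
  \<open>a\<close> and \<open>b\<close> are adjacent, these give \<open>H1\<close>,
  \<open>H2\<close>, \<open>H3\<close>, \<open>H5\<close>, \<open>H6\<close>, \<open>H4\<close>.
  Otherwise the first four give \<open>H7\<close>, \<open>H8\<close>, \<open>H10\<close>,
  \<open>H9\<close>, and the last two reduce to adjacent centres.\<close>

lemma (in pair_graph) forbidden_of_crossed_cherries:
  assumes "crossed_cherries G a a1 a2 b b1 b2"
  shows "\<exists>F \<in> {H1, H2, H3, H4, H5, H6, H7, H8, H9, H10}. contains_induced G F"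
proof -
  define found where "found \<longleftrightarrow> (\<exists>F \<in> {H1, H2, H3, H4, H5, H6, H7, H8, H9, H10}. contains_induced G F)"
  define P where "P = crossed_cherries G"
  define adj where "adj u v \<longleftrightarrow> (u, v) \<in> parcs G" for u v
  have adj_sym: "adj u v \<longleftrightarrow> adj v u" for u v
    unfolding adj_def by (rule parcs_sym)
  \<comment> \<open>\<open>P\<close> settles every pair except the five open ones, so
    \<open>E\<close> only has to record those.\<close>
  have contains: "contains_induced G (six_graph E)"
    if "P a a1 a2 b b1 b2" "adj a b \<longleftrightarrow> (Va, Vb) \<in> E"
      "adj a1 b1 \<longleftrightarrow> (Va1, Vb1) \<in> E" "adj a1 b2 \<longleftrightarrow> (Va1, Vb2) \<in> E"
      "adj a2 b1 \<longleftrightarrow> (Va2, Vb1) \<in> E" "adj a2 b2 \<longleftrightarrow> (Va2, Vb2) \<in> E"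
      "E \<subseteq> {(Va, Vb), (Va1, Vb1), (Va1, Vb2), (Va2, Vb1), (Va2, Vb2)}"
    for a a1 a2 b b1 b2 E
  proof (rule contains_six_graphI)
    have "(x, y) \<notin> E"
      if "(x, y) \<notin> {(Va, Vb), (Va1, Vb1), (Va1, Vb2), (Va2, Vb1), (Va2, Vb2)}" for x y
      using that \<open>E \<subseteq> _\<close> by blast
    then show "\<forall>x y. (x, y) \<in> parcs (six_graph E) \<longleftrightarrow>
      (case_six_vertex a a1 a2 b b1 b2 x, case_six_vertex a a1 a2 b b1 b2 y) \<in> parcs G"
      using that(1-6) unfolding all_six_vertex P_def adj_def crossed_cherries_def
      by (simp add: parcs_six_graph Let_def parcs_irrefl parcs_sym[of b] parcs_sym[of _ a]
        parcs_sym[of a2 a1] parcs_sym[of b2 b1] parcs_sym[of b1 a1] parcs_sym[of b2 a1]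
        parcs_sym[of b1 a2] parcs_sym[of b2 a2])
    show "irrefl E"
      using \<open>E \<subseteq> _\<close> by (auto simp: irrefl_def)
  qed (use that P_def in simp)
  have found_if: found
    if "contains_induced G F" "F \<in> {H1, H2, H3, H4, H5, H6, H7, H8, H9, H10}" for F
    using that unfolding found_def by blast
  have swap: "P b b1 b2 a a1 a2" "P a a2 a1 b b1 b2" if "P a a1 a2 b b1 b2" for a a1 a2 b b1 b2
    using that parcs_sym unfolding P_def crossed_cherries_def by auto
  \<comment> \<open>These are the seven nontrivial elements of the symmetry group of order 8
    generated by the two exchanges in \<open>swap\<close>.\<close>
  have relabel: "P a a2 a1 b b1 b2" "P a a1 a2 b b2 b1" "P a a2 a1 b b2 b1"
    "P b b1 b2 a a1 a2" "P b b2 b1 a a1 a2" "P b b1 b2 a a2 a1" "P b b2 b1 a a2 a1"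
    if "P a a1 a2 b b1 b2" for a a1 a2 b b1 b2
    using that swap by blast+
  have h1: found
    if "P a a1 a2 b b1 b2" "adj a b"
      "\<not> adj a1 b1" "\<not> adj a1 b2" "\<not> adj a2 b1" "\<not> adj a2 b2" for a a1 a2 b b1 b2
    using that by (intro found_if[of H1]) (simp add: H1_def contains, simp)
  have h2: found
    if "P a a1 a2 b b1 b2" "adj a b"
      "\<not> adj a1 b1" "\<not> adj a1 b2" "adj a2 b1" "\<not> adj a2 b2" for a a1 a2 b b1 b2
    using that by (intro found_if[of H2]) (simp add: H2_def contains, simp)
  have h3: found
    if "P a a1 a2 b b1 b2" "adj a b"
      "\<not> adj a1 b1" "\<not> adj a1 b2" "adj a2 b1" "adj a2 b2" for a a1 a2 b b1 b2
    using that by (intro found_if[of H3]) (simp add: H3_def contains, simp)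
  have h4: found
    if "P a a1 a2 b b1 b2" "adj a b"
      "adj a1 b1" "adj a1 b2" "adj a2 b1" "adj a2 b2" for a a1 a2 b b1 b2
    using that by (intro found_if[of H4]) (simp add: H4_def contains, simp)
  have h5: found
    if "P a a1 a2 b b1 b2" "adj a b"
      "\<not> adj a1 b1" "adj a1 b2" "adj a2 b1" "\<not> adj a2 b2" for a a1 a2 b b1 b2
    using that by (intro found_if[of H5]) (simp add: H5_def contains, simp)
  have h6: found
    if "P a a1 a2 b b1 b2" "adj a b"
      "\<not> adj a1 b1" "adj a1 b2" "adj a2 b1" "adj a2 b2" for a a1 a2 b b1 b2
    using that by (intro found_if[of H6]) (simp add: H6_def contains, simp)
  have adjacent: found if "P a a1 a2 b b1 b2" "adj a b" for a a1 a2 b b1 b2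
  proof -
    have sym: "adj b a" "adj b1 a1 \<longleftrightarrow> adj a1 b1" "adj b1 a2 \<longleftrightarrow> adj a2 b1"
      "adj b2 a1 \<longleftrightarrow> adj a1 b2" "adj b2 a2 \<longleftrightarrow> adj a2 b2"
      using that(2) adj_sym by blast+
    show ?thesis
      by (cases "adj a1 b1"; cases "adj a1 b2"; cases "adj a2 b1"; cases "adj a2 b2";
          insert that relabel[OF that(1)] sym; simp; metis h1 h2 h3 h4 h5 h6)
  qed
  have h7: found
    if "P a a1 a2 b b1 b2" "\<not> adj a b"
      "\<not> adj a1 b1" "\<not> adj a1 b2" "\<not> adj a2 b1" "\<not> adj a2 b2" for a a1 a2 b b1 b2
    using that by (intro found_if[of H7]) (simp add: H7_def contains, simp)
  have h8: found
    if "P a a1 a2 b b1 b2" "\<not> adj a b"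
      "adj a1 b1" "\<not> adj a1 b2" "\<not> adj a2 b1" "\<not> adj a2 b2" for a a1 a2 b b1 b2
    using that by (intro found_if[of H8]) (simp add: H8_def contains, simp)
  have h9: found
    if "P a a1 a2 b b1 b2" "\<not> adj a b"
      "adj a1 b1" "\<not> adj a1 b2" "\<not> adj a2 b1" "adj a2 b2" for a a1 a2 b b1 b2
    using that by (intro found_if[of H9]) (simp add: H9_def contains, simp)
  have h10: found
    if "P a a1 a2 b b1 b2" "\<not> adj a b"
      "adj a1 b1" "adj a1 b2" "\<not> adj a2 b1" "\<not> adj a2 b2" for a a1 a2 b b1 b2
    using that by (intro found_if[of H10]) (simp add: H10_def contains, simp)
  text \<open>With at least three of the four edges between \<open>{a\<^sub>1, a\<^sub>2}\<close> and \<open>{b\<^sub>1, b\<^sub>2}\<close>, there are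
    also crossed cherries with adjacent centres.\<close>
  have three: found
    if "P a a1 a2 b b1 b2" "\<not> adj a b" "adj a1 b1" "adj a1 b2" "adj a2 b1" for a a1 a2 b b1 b2
  proof (rule adjacent)
    \<comment> \<open>The independent triples \<open>{a, b1, b2}\<close> and
      \<open>{b, a1, a2}\<close> are unchanged; only the vertex serving as centre in each is now
      \<open>b1\<close> and \<open>a1\<close>.\<close>
    show "P a1 a b2 b1 b a2"
      using that unfolding P_def crossed_cherries_def adj_def
      by (auto simp: parcs_sym[of a1 a] parcs_sym[of b1 b] parcs_sym[of b1 a2]
        parcs_sym[of a1 b] parcs_sym[of b1 a])
  qed fact
  have nonadjacent: found if "P a a1 a2 b b1 b2" "\<not> adj a b" for a a1 a2 b b1 b2
  proof -
    have sym: "\<not> adj b a" "adj b1 a1 \<longleftrightarrow> adj a1 b1" "adj b1 a2 \<longleftrightarrow> adj a2 b1"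
      "adj b2 a1 \<longleftrightarrow> adj a1 b2" "adj b2 a2 \<longleftrightarrow> adj a2 b2"
      using that(2) adj_sym by blast+
    show ?thesis
      by (cases "adj a1 b1"; cases "adj a1 b2"; cases "adj a2 b1"; cases "adj a2 b2";
          insert that relabel[OF that(1)] sym; simp; metis h7 h8 h9 h10 three)
  qed
  have found
    using assms adjacent nonadjacent unfolding P_def by blast
  then show ?thesis
    unfolding found_def .
qed

text \<open>The subgraph induced by the six vertices violates the equality, whichever of the ten
  graphs it is: \<open>{a, b}\<close> dominates it, while two independent triples cover it.\<close>

lemma (in pair_graph) not_perfect_of_crossed_cherries:
  assumes "crossed_cherries G a a1 a2 b b1 b2"
  shows "\<not> common_domination_perfect G"
proof -
  define V where "V = {a, a1, a2, b, b1, b2}"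
  define H where "H = \<lparr>pverts = V, parcs = {e \<in> parcs G. fst e \<in> V \<and> snd e \<in> V}\<rparr>"
  have "V \<subseteq> pverts G"
    using assms parcs_pverts by (auto simp: V_def crossed_cherries_def)
  then have ind: "induced_subgraph (with_proj H) (with_proj G)"
    by (simp add: induced_subgraph_with_proj_iff H_def)
  interpret H: pair_graph H
    by (rule pair_graph_induced_subgraph[OF ind])
  have cc: "crossed_cherries H a a1 a2 b b1 b2" and [simp]: "pverts H = V"
    using assms by (simp_all add: crossed_cherries_def H_def V_def)
  have "dominating_set H {a, b}"
    using cc H.parcs_sym by (auto simp: dominating_set_def V_def crossed_cherries_def)
  then have "domination_number H \<le> card {a, b}"
    unfolding domination_number_def by (blast intro: Least_le)
  also have "\<dots> = 2"
    using cc by (simp add: crossed_cherries_def)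
  finally have "domination_number H \<le> 2" .
  moreover have "3 \<le> common_independence_number H"
  proof (rule common_independence_number_attained(2))
    have ind: "independent_set H {a, b1, b2}" "independent_set H {b, a1, a2}"
      using cc H.parcs_sym H.parcs_irrefl
      by (auto simp: independent_set_def V_def crossed_cherries_def)
    have card: "card {a, b1, b2} = 3" "card {b, a1, a2} = 3"
      using cc by (auto simp: crossed_cherries_def)
    fix v assume "v \<in> pverts H"
    then have "v \<in> {a, b1, b2} \<or> v \<in> {b, a1, a2}"
      by (auto simp: V_def)
    with ind card show "\<exists>S. independent_set H S \<and> v \<in> S \<and> 3 \<le> card S"
      by (metis order_refl)
  qed (use H.pair_graph_axioms in \<open>auto simp: V_def\<close>)
  ultimately have "domination_number H \<noteq> common_independence_number H" by linarith
  with ind show ?thesis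
    unfolding common_domination_perfect_def by (auto simp: V_def)
qed

section \<open>Domination and independence without crossed cherries\<close>

lemma (in pair_graph) finite_independent_set:
  "independent_set G I \<Longrightarrow> finite I"
  using pair_finite_verts by (auto simp: independent_set_def intro: finite_subset)

text \<open>A largest independent set through \<open>v\<close> cannot be extended, hence it is
  dominating.\<close>

lemma (in pair_graph) domination_number_le_common_independence_number:
  assumes "pverts G \<noteq> {}"
  shows "domination_number G \<le> common_independence_number G"
proof (rule common_independence_number_attained(2))
  fix v assume v: "v \<in> pverts G"
  let ?P = "\<lambda>S. independent_set G S \<and> v \<in> S"
  have "?P {v}"
    using v parcs_irrefl by (auto simp: independent_set_def)
  moreover have "\<forall>S. ?P S \<longrightarrow> card S < Suc (card (pverts G))"
    using pair_finite_verts by (auto simp: independent_set_def less_Suc_eq_le intro: card_mono)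
  ultimately obtain S where S: "?P S" and max: "\<And>T. ?P T \<Longrightarrow> card T \<le> card S"
    using ex_has_greatest_nat[of ?P _ card] by blast
  have "finite S"
    using S finite_independent_set by blast
  have "dominating_set G S"
    unfolding dominating_set_def
  proof (intro conjI ballI)
    fix u assume u: "u \<in> pverts G - S"
    show "\<exists>w \<in> S. (u, w) \<in> parcs G"
    proof (rule ccontr)
      assume "\<not> ?thesis"
      then have "?P (insert u S)"
        using S u parcs_irrefl parcs_sym by (auto simp: independent_set_def)
      from max[OF this] show False
        using u \<open>finite S\<close> by simp
    qed
  qed (use S in \<open>auto simp: independent_set_def\<close>)
  then have "domination_number G \<le> card S"
    unfolding domination_number_def by (blast intro: Least_le)
  with S show "\<exists>S. independent_set G S \<and> v \<in> S \<and> domination_number G \<le> card S"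
    by blast
qed (fact pair_graph_axioms assms)+

section \<open>Roots of dominating sets\<close>

definition closed_nbhd :: "'a pair_pre_digraph \<Rightarrow> 'a \<Rightarrow> 'a set" where
  "closed_nbhd G v = insert v {u. (v, u) \<in> parcs G}"

text \<open>Being a clique is expressed as meeting every independent set at most once, the form in
  which it is counted later. If both differences fail, each contains a nonadjacent pair, and these
  pairs are the leaves of crossed cherries.\<close>

lemma (in pair_graph) closed_nbhd_diff_card_le_1:
  assumes free: "\<nexists>a a1 a2 b b1 b2. crossed_cherries G a a1 a2 b b1 b2" and "a \<noteq> b"
  shows "(\<forall>I. independent_set G I \<longrightarrow> card (I \<inter> (closed_nbhd G b - closed_nbhd G a)) \<le> 1) \<or>
         (\<forall>I. independent_set G I \<longrightarrow> card (I \<inter> (closed_nbhd G a - closed_nbhd G b)) \<le> 1)"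
proof -
  have cherry: "\<exists>x y. x \<noteq> y \<and> x \<noteq> b \<and> y \<noteq> b \<and> (x, y) \<notin> parcs G \<and> (a, x) \<in> parcs G \<and>
      (a, y) \<in> parcs G \<and> (b, x) \<notin> parcs G \<and> (b, y) \<notin> parcs G"
    if I: "independent_set G I" "\<not> card (I \<inter> (closed_nbhd G a - closed_nbhd G b)) \<le> 1" for a b I
  proof -
    have "finite I"
      using I finite_independent_set by blast
    \<comment> \<open>Neither vertex is \<open>a\<close>, because \<open>a\<close> is adjacent to
      every other member of \<open>closed_nbhd G a\<close>.\<close>
    then obtain x y where xy: "x \<noteq> y" "x \<in> I" "y \<in> I"
        "{x, y} \<subseteq> closed_nbhd G a - closed_nbhd G b"
      using I(2) by (auto simp: card_le_Suc0_iff_eq)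
    moreover have "(x, y) \<notin> parcs G" "(y, x) \<notin> parcs G"
      using I(1) xy by (auto simp: independent_set_def)
    ultimately show ?thesis
      by (intro exI[of _ x] exI[of _ y]) (auto simp: closed_nbhd_def)
  qed
  show ?thesis
  proof (rule ccontr)
    assume "\<not> ?thesis"
    then obtain a1 a2 b1 b2 where
      "a1 \<noteq> a2 \<and> a1 \<noteq> b \<and> a2 \<noteq> b \<and> (a1, a2) \<notin> parcs G \<and> (a, a1) \<in> parcs G \<and>
        (a, a2) \<in> parcs G \<and> (b, a1) \<notin> parcs G \<and> (b, a2) \<notin> parcs G"
      "b1 \<noteq> b2 \<and> b1 \<noteq> a \<and> b2 \<noteq> a \<and> (b1, b2) \<notin> parcs G \<and> (b, b1) \<in> parcs G \<and>
        (b, b2) \<in> parcs G \<and> (a, b1) \<notin> parcs G \<and> (a, b2) \<notin> parcs G"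
      using cherry[of _ a b] cherry[of _ b a] by meson
    \<comment> \<open>The \<open>ai\<close> differ from the \<open>bj\<close> since the former are
      adjacent to \<open>a\<close> and the latter are not.\<close>
    then have "crossed_cherries G a a1 a2 b b1 b2"
      using \<open>a \<noteq> b\<close> parcs_irrefl by (auto simp: crossed_cherries_def)
    with free show False by blast
  qed
qed

text \<open>Outside the closed neighbourhood of the root there is one clique for each further
  element of \<open>S\<close>, so the bound is strict; the spare unit later pays for the root
  itself.\<close>

lemma (in pair_graph) ex_root:
  assumes free: "\<nexists>a a1 a2 b b1 b2. crossed_cherries G a a1 a2 b b1 b2"
    and "finite S" "S \<noteq> {}"
  shows "\<exists>a \<in> S. \<forall>I. independent_set G I \<and> I \<subseteq> (\<Union>s \<in> S. closed_nbhd G s) - closed_nbhd G a \<longrightarrow>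
    card I < card S"
  using assms(2,3)
proof (induction S rule: finite_ne_induct)
  case (singleton s)
  then show ?case by auto
next
  case (insert s S)
  let ?N = "closed_nbhd G"
  obtain a where a: "a \<in> S" and IH:
    "\<And>I. independent_set G I \<Longrightarrow> I \<subseteq> (\<Union>s \<in> S. ?N s) - ?N a \<Longrightarrow> card I < card S"
    using insert.IH by blast
  have "a \<noteq> s" using a insert.hyps by blast
  \<comment> \<open>\<open>B\<close> is the clique contributed by \<open>s\<close>; the rest of
    \<open>I\<close> is bounded by the induction hypothesis for the old root
    \<open>a\<close>.\<close>
  have step: "card I < card (insert s S)"
    if I: "independent_set G I" "card (I \<inter> B) \<le> 1" "I - B \<subseteq> (\<Union>s \<in> S. ?N s) - ?N a" for I B
  proof -
    have "card I \<le> card (I \<inter> B) + card (I - B)"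
      by (metis Int_Diff_Un card_Un_le)
    moreover have "independent_set G (I - B)"
      using I(1) by (auto simp: independent_set_def)
    ultimately show ?thesis
      using IH[of "I - B"] I insert.hyps by simp
  qed
  from closed_nbhd_diff_card_le_1[OF free \<open>a \<noteq> s\<close>] show ?case
  proof
    \<comment> \<open>The root stays \<open>a\<close>: \<open>I\<close> avoids \<open>?N a\<close>,
      so what is left after removing the clique also avoids \<open>?N s\<close>.\<close>
    assume clique: "\<forall>I. independent_set G I \<longrightarrow> card (I \<inter> (?N s - ?N a)) \<le> 1"
    show ?case
    proof (intro bexI allI impI)
      fix I assume "independent_set G I \<and> I \<subseteq> (\<Union>s \<in> insert s S. ?N s) - ?N a"
      then show "card I < card (insert s S)"
        using clique by (intro step[of I "?N s - ?N a"]) auto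
    qed (use a in simp)
  next
    \<comment> \<open>The root becomes \<open>s\<close>: \<open>I\<close> avoids
      \<open>?N s\<close>, so removing the clique makes it avoid \<open>?N a\<close>, as the old
      root requires.\<close>
    assume clique: "\<forall>I. independent_set G I \<longrightarrow> card (I \<inter> (?N a - ?N s)) \<le> 1"
    show ?case
    proof (intro bexI allI impI)
      fix I assume "independent_set G I \<and> I \<subseteq> (\<Union>s \<in> insert s S. ?N s) - ?N s"
      then show "card I < card (insert s S)"
        using clique by (intro step[of I "?N a - ?N s"]) auto
    qed simp
  qed
qed

lemma (in pair_graph) common_independence_number_le_domination_number:
  assumes free: "\<nexists>a a1 a2 b b1 b2. crossed_cherries G a a1 a2 b b1 b2" and "pverts G \<noteq> {}"
  shows "common_independence_number G \<le> domination_number G"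
proof -
  obtain S where S: "dominating_set G S" and card_S: "card S = domination_number G"
    using domination_number_attained by blast
  have S_sub: "S \<subseteq> pverts G" and "S \<noteq> {}"
    using S assms(2) by (auto simp: dominating_set_def)
  then have "finite S"
    using pair_finite_verts finite_subset by blast
  from ex_root[OF free \<open>finite S\<close> \<open>S \<noteq> {}\<close>] obtain a where a: "a \<in> S" and root:
    "\<And>I. independent_set G I \<Longrightarrow>
      I \<subseteq> (\<Union>s \<in> S. closed_nbhd G s) - closed_nbhd G a \<Longrightarrow> card I < card S"
    by blast
  \<comment> \<open>The common independence number is tested at the root alone. Independence keeps
    the rest of \<open>I\<close> out of \<open>closed_nbhd G a\<close>, so
    \<open>card I - 1 < card S\<close>.\<close>
  obtain I where I: "independent_set G I" "a \<in> I" "common_independence_number G \<le> card I"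
    using common_independence_number_attained(1)[OF pair_graph_axioms assms(2)] a S_sub by blast
  have "finite I"
    using I finite_independent_set by blast
  have "pverts G \<subseteq> (\<Union>s \<in> S. closed_nbhd G s)"
    using S parcs_sym by (fastforce simp: dominating_set_def closed_nbhd_def)
  then have "I - {a} \<subseteq> (\<Union>s \<in> S. closed_nbhd G s) - closed_nbhd G a"
    using I by (auto simp: independent_set_def closed_nbhd_def)
  moreover have "independent_set G (I - {a})"
    using I by (auto simp: independent_set_def)
  ultimately have "card (I - {a}) < card S"
    using root by blast
  then show ?thesis
    using I \<open>finite I\<close> card_S by simp
qed

section \<open>Passing to induced subgraphs, and the equivalence\<close>

lemma (in pair_graph) perfect_of_no_crossed_cherries:
  assumes free: "\<nexists>a a1 a2 b b1 b2. crossed_cherries G a a1 a2 b b1 b2"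
  shows "common_domination_perfect G"
  unfolding common_domination_perfect_def
proof (intro allI impI, elim conjE)
  fix H :: "'a pair_pre_digraph"
  assume ind: "induced_subgraph (with_proj H) (with_proj G)" and ne: "pverts H \<noteq> {}"
  interpret H: pair_graph H
    by (rule pair_graph_induced_subgraph[OF ind])
  have arcs: "(u, v) \<in> parcs H \<longleftrightarrow> (u, v) \<in> parcs G" if "u \<in> pverts H" "v \<in> pverts H" for u v
    unfolding ind[unfolded induced_subgraph_with_proj_iff, THEN conjunct2] using that by simp
  \<comment> \<open>Crossed cherries of \<open>H\<close> remain such in \<open>G\<close>, so their
    absence is hereditary and both inequalities apply to \<open>H\<close>.\<close>
  have "crossed_cherries G a a1 a2 b b1 b2"
    if cc: "crossed_cherries H a a1 a2 b b1 b2" for a a1 a2 b b1 b2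
  proof -
    have "{a, a1, a2, b, b1, b2} \<subseteq> pverts H"
      using cc H.parcs_pverts unfolding crossed_cherries_def by blast
    then show ?thesis
      using cc by (simp add: crossed_cherries_def arcs)
  qed
  with free have "\<nexists>a a1 a2 b b1 b2. crossed_cherries H a a1 a2 b b1 b2" by blast
  then show "domination_number H = common_independence_number H"
    by (intro le_antisym H.domination_number_le_common_independence_number
        H.common_independence_number_le_domination_number ne)
qed

theorem theorem1:
  fixes G :: "'a pair_pre_digraph"
  assumes "pair_graph G" and "pverts G \<noteq> {}"
  shows "common_domination_perfect G \<longleftrightarrow>
    (\<forall>F \<in> {H1, H2, H3, H4, H5, H6, H7, H8, H9, H10}. \<not> contains_induced G F)"
proof -
  interpret pair_graph G by fact
  show ?thesis
    using crossed_cherries_of_forbidden forbidden_of_crossed_cherries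
      not_perfect_of_crossed_cherries perfect_of_no_crossed_cherries by metis
qed

end
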